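(* Let $G\in\mathcal{G}_n^{sc}$ with Hermitian adjacency matrix $A$ and walk-matrix $W=[e,Ae,\ldots,A^{n-1}e]$ such that $\det W\neq 0$. Then $G$ is determined by its generalized (Hermitian) spectrum if and only if $\mathscr{U}_G$ contains only permutation matrices.
   Context: A mixed graph is obtained from a simple undirected graph by orienting a subset of edges; $\mathcal{G}_n$ is the set of mixed graphs on $[n]$. The Hermitian adjacency matrix $A(G)=(a_{u,v})$ has $a_{u,v}=1$ for an undirected edge $uv$, $i$ for a directed edge $u\to v$, $-i$ for a directed edge $v\to u$, $0$ otherwise. $G$ is self-converse if it is isomorphic to the mixed graph obtained by reversing every directed edge; $\mathcal{G}_n^{sc}$ is the set of self-converse mixed graphs on $[n]$. $e$ is the all-one vector, $J$ the all-one matrix, $\mathrm{Spec}(M)$ the multiset of eigenvalues of $M$. $G\in\mathcal{G}_n^{sc}$ is determined by its generalized (Hermitian) spectrum if for every $H\in\mathcal{G}_n^{sc}$, $(\mathrm{Spec}(A(H)),\mathrm{Spec}(J-I-A(H)))=(\mathrm{Spec}(A(G)),\mathrm{Spec}(J-I-A(G)))$ implies that $H$ is isomorphic to $G$. A Gaussian rational matrix has entries with rational real and imaginary parts. $\mathscr{U}_G$ is the set of Gaussian rational unitary matrices $U$ ($U^*U=I$) with $Ue=e$ and $U^*A(G)U=A(H)$ for some $H\in\mathcal{G}_n^{sc}$. *)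

theory Defs
  imports
    "Jordan_Normal_Form.Schur_Decomposition"
    "Jordan_Normal_Form.Spectral_Radius"
begin

text \<open>
  A mixed graph is stored as its set of unoriented edges together with its set of oriented edges;
  the vertex set $[n]$ is \<open>{..<n}\<close>.  The simple graph it is obtained from has the edge set
  \<open>uedges G \<union> {{u, v} | u v. (u, v) \<in> arcs G}\<close>.  Each of its edges is either left undirected
  or oriented in exactly one of the two directions.
\<close>

record mixed_graph =
  uedges :: "nat set set"
  arcs :: "(nat \<times> nat) set"

definition mixed_graphs :: "nat \<Rightarrow> mixed_graph set" where
  "mixed_graphs n = {G.
     uedges G \<subseteq> {{u, v} | u v. u < n \<and> v < n \<and> u \<noteq> v} \<and>
     arcs G \<subseteq> {(u, v). u < n \<and> v < n \<and> u \<noteq> v} \<and>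
     (\<forall>u v. (u, v) \<in> arcs G \<longrightarrow> (v, u) \<notin> arcs G \<and> {u, v} \<notin> uedges G)}"

definition mg_isomorphic :: "nat \<Rightarrow> mixed_graph \<Rightarrow> mixed_graph \<Rightarrow> bool" where
  "mg_isomorphic n G H \<longleftrightarrow> (\<exists>f. bij_betw f {..<n} {..<n} \<and>
     (\<forall>u<n. \<forall>v<n. ({u, v} \<in> uedges G \<longleftrightarrow> {f u, f v} \<in> uedges H) \<and>
                   ((u, v) \<in> arcs G \<longleftrightarrow> (f u, f v) \<in> arcs H)))"

definition mg_converse :: "mixed_graph \<Rightarrow> mixed_graph" where
  "mg_converse G = \<lparr>uedges = uedges G, arcs = (arcs G)\<inverse>\<rparr>"

definition sc_mixed_graphs :: "nat \<Rightarrow> mixed_graph set" where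
  "sc_mixed_graphs n = {G \<in> mixed_graphs n. mg_isomorphic n G (mg_converse G)}"

definition herm_adj :: "nat \<Rightarrow> mixed_graph \<Rightarrow> complex mat" where
  "herm_adj n G = mat n n (\<lambda>(u, v).
     if {u, v} \<in> uedges G then 1
     else if (u, v) \<in> arcs G then \<i>
     else if (v, u) \<in> arcs G then - \<i>
     else 0)"

definition ones_vec :: "nat \<Rightarrow> complex vec" where
  "ones_vec n = vec n (\<lambda>_. 1)"

definition ones_mat :: "nat \<Rightarrow> complex mat" where
  "ones_mat n = mat n n (\<lambda>_. 1)"

definition walk_matrix :: "nat \<Rightarrow> complex mat \<Rightarrow> complex mat" where
  "walk_matrix n A = mat_of_cols n (map (\<lambda>k. (A ^\<^sub>m k) *\<^sub>v ones_vec n) [0..<n])"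

text \<open>Eigenvalues counted with algebraic multiplicity.\<close>

definition Spec :: "complex mat \<Rightarrow> complex multiset" where
  "Spec M = proots (char_poly M)"

lemma set_mset_Spec:
  assumes "M \<in> carrier_mat n n"
  shows "set_mset (Spec M) = spectrum M"
proof -
  have "char_poly M \<noteq> 0"
    using degree_monic_char_poly[OF assms] by auto
  then show ?thesis
    by (auto simp: Spec_def spectrum_def eigenvalue_root_char_poly[OF assms])
qed

definition determined_by_gen_spectrum :: "nat \<Rightarrow> mixed_graph \<Rightarrow> bool" where
  "determined_by_gen_spectrum n G \<longleftrightarrow> (\<forall>H \<in> sc_mixed_graphs n.
     (Spec (herm_adj n H), Spec (ones_mat n - 1\<^sub>m n - herm_adj n H)) =
     (Spec (herm_adj n G), Spec (ones_mat n - 1\<^sub>m n - herm_adj n G))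
     \<longrightarrow> mg_isomorphic n H G)"

definition gaussian_rational_mat :: "complex mat \<Rightarrow> bool" where
  "gaussian_rational_mat U \<longleftrightarrow>
     (\<forall>i<dim_row U. \<forall>j<dim_col U. Re (U $$ (i, j)) \<in> \<rat> \<and> Im (U $$ (i, j)) \<in> \<rat>)"

definition unitary_set :: "nat \<Rightarrow> mixed_graph \<Rightarrow> complex mat set" where
  "unitary_set n G = {U \<in> carrier_mat n n.
     gaussian_rational_mat U \<and>
     mat_adjoint U * U = 1\<^sub>m n \<and>
     U *\<^sub>v ones_vec n = ones_vec n \<and>
     (\<exists>H \<in> sc_mixed_graphs n. mat_adjoint U * herm_adj n G * U = herm_adj n H)}"

definition permutation_matrices :: "nat \<Rightarrow> complex mat set" where
  "permutation_matrices n =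
     {mat n n (\<lambda>(i, j). if i = p j then 1 else 0) | p. p permutes {..<n}}"

end

theory Submission
  imports Defs
begin

text \<open>
  The generalized spectrum fixes the characteristic polynomials of \<open>A\<close> and \<open>J - I - A\<close>. As \<open>J\<close>
  has rank one, their quotient is, up to a change of variable, the generating function of the
  numbers \<open>e\<^sup>T A\<^sup>k e\<close>, so these are determined too. Since \<open>A\<close> is Hermitian, they are the entries of
  \<open>W\<^sup>* W\<close> and \<open>W\<^sup>* A W\<close>. Hence if \<open>G\<close> and \<open>H\<close> have the same generalized spectrum, then
  \<open>U = W(G) W(H)\<inverse>\<close> is a Gaussian rational unitary matrix that fixes \<open>e\<close> and conjugates \<open>A(G)\<close> to
  \<open>A(H)\<close>; if it is a permutation matrix, then \<open>G\<close> and \<open>H\<close> are isomorphic.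

  Conversely, a member \<open>U\<close> of the unitary set preserves the generalized spectrum, so its graph \<open>H\<close>
  is isomorphic to \<open>G\<close> through some permutation matrix \<open>P\<close>. Then \<open>U P\<^sup>*\<close> commutes with \<open>A\<close> and
  fixes \<open>e\<close>, hence fixes every column of the invertible matrix \<open>W\<close>, and \<open>U = P\<close>.
\<close>

section \<open>Walk counts and the generalized spectrum\<close>

text \<open>Sylvester's identity. The block matrices \<open>?X\<close> and \<open>?L\<close>
  multiply to a block upper triangular matrix in either order, with determinant
  \<open>det (1 + B * C)\<close> in one order and \<open>det (1 + C * B)\<close> in the
  other.\<close>

lemma det_one_plus_mult_commute:
  fixes B :: "'a :: idom mat"
  assumes B: "B \<in> carrier_mat n m" and C: "C \<in> carrier_mat m n"
  shows "det (1\<^sub>m n + B * C) = det (1\<^sub>m m + C * B)"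
proof -
  let ?X = "four_block_mat (1\<^sub>m n) B (- C) (1\<^sub>m m)"
  let ?L = "four_block_mat (1\<^sub>m n) (0\<^sub>m n m) C (1\<^sub>m m)"
  have X: "?X \<in> carrier_mat (n + m) (n + m)" and L: "?L \<in> carrier_mat (n + m) (n + m)"
    using B C by auto
  have "?X * ?L = four_block_mat (1\<^sub>m n * 1\<^sub>m n + B * C) (1\<^sub>m n * 0\<^sub>m n m + B * 1\<^sub>m m)
      (- C * 1\<^sub>m n + 1\<^sub>m m * C) (- C * 0\<^sub>m n m + 1\<^sub>m m * 1\<^sub>m m)"
    using B C by (intro mult_four_block_mat) auto
  also have "\<dots> = four_block_mat (1\<^sub>m n + B * C) B (0\<^sub>m m n) (1\<^sub>m m)"
    using B C by (intro cong_four_block_mat) auto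
  finally have XL: "?X * ?L = four_block_mat (1\<^sub>m n + B * C) B (0\<^sub>m m n) (1\<^sub>m m)" .
  have "?L * ?X = four_block_mat (1\<^sub>m n * 1\<^sub>m n + 0\<^sub>m n m * - C) (1\<^sub>m n * B + 0\<^sub>m n m * 1\<^sub>m m)
      (C * 1\<^sub>m n + 1\<^sub>m m * - C) (C * B + 1\<^sub>m m * 1\<^sub>m m)"
    using B C by (intro mult_four_block_mat) auto
  also have "\<dots> = four_block_mat (1\<^sub>m n) B (0\<^sub>m m n) (1\<^sub>m m + C * B)"
    using B C by (intro cong_four_block_mat) (auto simp: comm_add_mat[of _ m m] minus_add_uminus_mat[symmetric])
  finally have LX: "?L * ?X = four_block_mat (1\<^sub>m n) B (0\<^sub>m m n) (1\<^sub>m m + C * B)" .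
  have "det (1\<^sub>m n + B * C) = det (?X * ?L)"
    unfolding XL using B C by (subst det_four_block_mat_lower_left_zero[of _ n _ m]) auto
  also have "\<dots> = det (?L * ?X)"
    using det_mult[OF X L] det_mult[OF L X] by simp
  also have "\<dots> = det (1\<^sub>m m + C * B)"
    unfolding LX using B C by (subst det_four_block_mat_lower_left_zero[of _ n _ m]) auto
  finally show ?thesis .
qed

text \<open>With column factor \<open>M v\<close>, the sum factors as \<open>M (1 + v w^T)\<close>,
  so the statement involves no inverse of \<open>M\<close>. Sylvester's identity then reduces the
  second factor to a 1 by 1 determinant.\<close>

lemma det_add_rank_one:
  fixes M :: "'a :: idom mat"
  assumes M: "M \<in> carrier_mat n n" and v: "v \<in> carrier_vec n" and w: "w \<in> carrier_vec n"
  shows "det (M + mat n n (\<lambda>(i, j). (M *\<^sub>v v) $ i * w $ j)) = det M * (1 + w \<bullet> v)"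
proof -
  define B where "B = mat n 1 (\<lambda>(i, j). v $ i)"
  define C where "C = mat 1 n (\<lambda>(i, j). w $ j)"
  have BC: "B \<in> carrier_mat n 1" "C \<in> carrier_mat 1 n" by (auto simp: B_def C_def)
  have B0: "col B 0 = v" using v by (auto simp: B_def)
  have "M * (1\<^sub>m n + B * C) = M * 1\<^sub>m n + (M * B) * C"
    using M BC by (subst mult_add_distrib_mat[of _ n n]) auto
  also have "(M * B) * C = mat n n (\<lambda>(i, j). (M *\<^sub>v v) $ i * w $ j)"
    using M BC B0 by (intro eq_matI) (auto simp: scalar_prod_def[of _ "vec (Suc 0) _"] C_def)
  finally have "det (M + mat n n (\<lambda>(i, j). (M *\<^sub>v v) $ i * w $ j)) = det M * det (1\<^sub>m n + B * C)"
    using M BC by (simp add: det_mult[of _ n, symmetric])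
  also have "det (1\<^sub>m n + B * C) = det (1\<^sub>m 1 + C * B)"
    using BC by (rule det_one_plus_mult_commute)
  also have "\<dots> = 1 + w \<bullet> v"
    using BC v w by (subst det_single) (auto simp: scalar_prod_def B_def C_def)
  finally show ?thesis .
qed

section \<open>Continuity of determinants and adjugates\<close>

lemma continuous_det:
  fixes M :: "'a :: t2_space \<Rightarrow> 'b :: {real_normed_algebra_1, comm_ring_1} mat"
  assumes "\<And>z. M z \<in> carrier_mat n n"
    and "\<And>i j. i < n \<Longrightarrow> j < n \<Longrightarrow> continuous F (\<lambda>z. M z $$ (i, j))"
  shows "continuous F (\<lambda>z. det (M z))"
proof -
  have "continuous F (\<lambda>z. \<Sum>p | p permutes {0..<n}. signof p * (\<Prod>i = 0..<n. M z $$ (i, p i)))"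
    using assms(2) by (intro continuous_sum continuous_mult continuous_const continuous_prod) (auto simp: permutes_in_image)
  then show ?thesis
    using assms(1) by (simp add: det_def'[of _ n])
qed

lemma continuous_adj_mat:
  fixes M :: "'a :: t2_space \<Rightarrow> 'b :: {real_normed_algebra_1, comm_ring_1} mat"
  assumes M: "\<And>z. M z \<in> carrier_mat n n"
    and cont: "\<And>i j. i < n \<Longrightarrow> j < n \<Longrightarrow> continuous F (\<lambda>z. M z $$ (i, j))"
    and ij: "i < n" "j < n"
  shows "continuous F (\<lambda>z. adj_mat (M z) $$ (i, j))"
proof -
  have dims: "dim_row (M z) = n" "dim_col (M z) = n" for z using M[of z] by auto
  have "continuous F (\<lambda>z. det (mat_delete (M z) j i))"
  proof (rule continuous_det[of _ "n - 1"])
    show "mat_delete (M z) j i \<in> carrier_mat (n - 1) (n - 1)" for z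
      using M mat_delete_carrier by blast
    show "continuous F (\<lambda>z. mat_delete (M z) j i $$ (a, b))" if "a < n - 1" "b < n - 1" for a b
      using that ij by (auto simp: mat_delete_def dims intro!: cont)
  qed
  then show ?thesis
    using ij by (simp add: adj_mat_def cofactor_def dims continuous_mult continuous_const)
qed

section \<open>From spectra to determinants in a parameter\<close>

lemma ones_carrier [simp]: "ones_vec n \<in> carrier_vec n" "ones_mat n \<in> carrier_mat n n"
  by (auto simp: ones_vec_def ones_mat_def)

text \<open>A characteristic polynomial is monic and splits over the complex numbers, so its
  multiset of roots recovers it.\<close>

lemma char_poly_eq_if_Spec_eq:
  assumes "M \<in> carrier_mat n n" "N \<in> carrier_mat n n" "Spec M = Spec N"
  shows "char_poly M = char_poly N"
proof -
  have "char_poly C = (\<Prod>x\<in>#Spec C. [:- x, 1:])" if "C \<in> carrier_mat n n" for C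
  proof -
    have "lead_coeff (char_poly C) = 1" using degree_monic_char_poly[OF that] by simp
    then show ?thesis
      using complex_poly_decompose_multiset[of "char_poly C"] unfolding Spec_def by simp
  qed
  then show ?thesis using assms by metis
qed

lemma det_one_minus_smult:
  fixes A :: "'a :: field mat"
  assumes A: "A \<in> carrier_mat n n" and z: "z \<noteq> 0"
  shows "det (1\<^sub>m n - z \<cdot>\<^sub>m A) = z ^ n * poly (char_poly A) (1 / z)"
proof -
  have "1\<^sub>m n - z \<cdot>\<^sub>m A = z \<cdot>\<^sub>m (- char_matrix A (1 / z))"
    using A z by (intro eq_matI) (auto simp: char_matrix_def field_simps)
  then show ?thesis
    using A by (simp add: char_poly_matrix[OF A] char_matrix_def)
qed

text \<open>The matrix on the left is \<open>-z\<close> times \<open>t I - (J - I - A)\<close> with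
  \<open>t = -1/z - 1\<close>: the term \<open>-z t I\<close> equals \<open>(1 + z) I\<close>, whose
  surplus \<open>z I\<close> cancels against the \<open>I\<close> in the complement.\<close>

lemma det_one_minus_smult_plus_ones:
  assumes A: "A \<in> carrier_mat n n" and z: "z \<noteq> 0"
  shows "det (1\<^sub>m n - z \<cdot>\<^sub>m A + z \<cdot>\<^sub>m ones_mat n) =
    (- z) ^ n * poly (char_poly (ones_mat n - 1\<^sub>m n - A)) (- 1 / z - 1)"
proof -
  have C: "ones_mat n - 1\<^sub>m n - A \<in> carrier_mat n n" using A by (simp add: minus_carrier_mat)
  have "1\<^sub>m n - z \<cdot>\<^sub>m A + z \<cdot>\<^sub>m ones_mat n =
      (- z) \<cdot>\<^sub>m (- char_matrix (ones_mat n - 1\<^sub>m n - A) (- 1 / z - 1))"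
    using A z by (intro eq_matI) (auto simp: char_matrix_def ones_mat_def field_simps)
  then show ?thesis
    using A C by (simp add: char_poly_matrix[OF C] char_matrix_def)
qed

lemma smult_mat_mult_vec:
  fixes A :: "'a :: comm_semiring_0 mat"
  assumes "A \<in> carrier_mat nr nc" "v \<in> carrier_vec nc"
  shows "(c \<cdot>\<^sub>m A) *\<^sub>v v = c \<cdot>\<^sub>v (A *\<^sub>v v)"
  using assms by (intro eq_vecI) (auto simp: scalar_prod_def sum_distrib_left mult.assoc)

section \<open>Walk generating functions\<close>

definition walk_count :: "complex mat \<Rightarrow> nat \<Rightarrow> complex" where
  "walk_count A k = ones_vec (dim_row A) \<bullet> (A ^\<^sub>m k *\<^sub>v ones_vec (dim_row A))"

text \<open>\<open>det_resolvent A k z\<close> is \<open>det (I - zA)\<close> times the generating function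
  \<open>\<Sum>j. walk_count A (k + j) * z ^ j\<close>, in a form that also makes sense where \<open>I - zA\<close> is singular.\<close>

definition det_resolvent :: "complex mat \<Rightarrow> nat \<Rightarrow> complex \<Rightarrow> complex" where
  "det_resolvent A k z = ones_vec (dim_row A) \<bullet>
     (A ^\<^sub>m k *\<^sub>v (adj_mat (1\<^sub>m (dim_row A) - z \<cdot>\<^sub>m A) *\<^sub>v ones_vec (dim_row A)))"

text \<open>This splits off the constant coefficient of the generating function. For
  \<open>x = adj_mat M e\<close> with \<open>M = I - zA\<close>, the identity
  \<open>M x = det M e\<close> reads \<open>x = det M e + z A x\<close>; it remains to apply
  \<open>A^k\<close> and pair with \<open>e\<close>.\<close>

lemma det_resolvent_rec:
  assumes A: "A \<in> carrier_mat n n"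
  shows "det_resolvent A k z =
    det (1\<^sub>m n - z \<cdot>\<^sub>m A) * walk_count A k + z * det_resolvent A (Suc k) z"
proof -
  let ?e = "ones_vec n"
  define M where "M = 1\<^sub>m n - z \<cdot>\<^sub>m A"
  have M: "M \<in> carrier_mat n n" using A by (auto simp: M_def)
  define x where "x = adj_mat M *\<^sub>v ?e"
  have x: "x \<in> carrier_vec n" using adj_mat(1)[OF M] by (simp add: x_def)
  have Ax: "A *\<^sub>v x \<in> carrier_vec n" and P: "A ^\<^sub>m k \<in> carrier_mat n n"
    using A x by auto
  have "M *\<^sub>v x = (M * adj_mat M) *\<^sub>v ?e"
    using M adj_mat(1)[OF M] by (simp add: x_def)
  also have "\<dots> = det M \<cdot>\<^sub>v ?e"
    by (simp add: adj_mat(2)[OF M] smult_mat_mult_vec[of _ n n])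
  finally have "M *\<^sub>v x = det M \<cdot>\<^sub>v ?e" .
  moreover have "M *\<^sub>v x = x - z \<cdot>\<^sub>v (A *\<^sub>v x)"
    using A x by (simp add: M_def minus_mult_distrib_mat_vec[of _ n n] smult_mat_mult_vec[of _ n n])
  moreover have "x = (x - z \<cdot>\<^sub>v (A *\<^sub>v x)) + z \<cdot>\<^sub>v (A *\<^sub>v x)"
    using A x by (intro eq_vecI) auto
  ultimately have "x = det M \<cdot>\<^sub>v ?e + z \<cdot>\<^sub>v (A *\<^sub>v x)" by simp
  then have "A ^\<^sub>m k *\<^sub>v x = A ^\<^sub>m k *\<^sub>v (det M \<cdot>\<^sub>v ?e + z \<cdot>\<^sub>v (A *\<^sub>v x))"
    by (rule arg_cong)
  also have "\<dots> = det M \<cdot>\<^sub>v (A ^\<^sub>m k *\<^sub>v ?e) + z \<cdot>\<^sub>v (A ^\<^sub>m k *\<^sub>v (A *\<^sub>v x))"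
    using Ax by (simp add: mult_add_distrib_mat_vec[OF P] mult_mat_vec[OF P])
  also have "A ^\<^sub>m k *\<^sub>v (A *\<^sub>v x) = A ^\<^sub>m Suc k *\<^sub>v x"
    using A P x by (simp add: assoc_mult_mat_vec[of _ n n])
  finally have "A ^\<^sub>m k *\<^sub>v x = det M \<cdot>\<^sub>v (A ^\<^sub>m k *\<^sub>v ?e) + z \<cdot>\<^sub>v (A ^\<^sub>m Suc k *\<^sub>v x)" .
  moreover have "A ^\<^sub>m Suc k *\<^sub>v x \<in> carrier_vec n" "A ^\<^sub>m k *\<^sub>v ?e \<in> carrier_vec n"
    using mult_mat_vec_carrier[OF P] mult_mat_vec_carrier[OF pow_carrier_mat[OF A] x]
    by (simp_all del: pow_mat.simps)
  ultimately have "?e \<bullet> (A ^\<^sub>m k *\<^sub>v x) = det M * (?e \<bullet> (A ^\<^sub>m k *\<^sub>v ?e)) + z * (?e \<bullet> (A ^\<^sub>m Suc k *\<^sub>v x))"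
    by (simp add: scalar_prod_add_distrib[of _ n] scalar_prod_smult_distrib[of _ n] del: pow_mat.simps)
  then show ?thesis
    using A by (simp add: det_resolvent_def walk_count_def x_def M_def del: pow_mat.simps)
qed

lemma isCont_det_resolvent:
  assumes A: "A \<in> carrier_mat n n"
  shows "isCont (det_resolvent A k) z"
proof -
  have [simp]: "dim_row A = n" "dim_col A = n" using A by auto
  have P: "A ^\<^sub>m k \<in> carrier_mat n n" using A by simp
  have M: "1\<^sub>m n - w \<cdot>\<^sub>m A \<in> carrier_mat n n" for w using A by auto
  have adj: "isCont (\<lambda>w. adj_mat (1\<^sub>m n - w \<cdot>\<^sub>m A) $$ (i, j)) z" if "i < n" "j < n" for i j
    using that by (intro continuous_adj_mat[OF M]) (auto intro!: continuous_intros)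
  have "det_resolvent A k w = (\<Sum>i<n. \<Sum>j<n. (A ^\<^sub>m k) $$ (i, j) * (\<Sum>l<n. adj_mat (1\<^sub>m n - w \<cdot>\<^sub>m A) $$ (j, l)))" for w
    using P adj_mat(1)[OF M[of w]]
    by (auto simp: det_resolvent_def scalar_prod_def ones_vec_def lessThan_atLeast0 intro!: sum.cong)
  then have "det_resolvent A k =
      (\<lambda>w. \<Sum>i<n. \<Sum>j<n. (A ^\<^sub>m k) $$ (i, j) * (\<Sum>l<n. adj_mat (1\<^sub>m n - w \<cdot>\<^sub>m A) $$ (j, l)))"
    by (rule ext)
  then show ?thesis
    by (auto intro!: continuous_intros adj)
qed

text \<open>For small nonzero \<open>z\<close> the two characteristic polynomials fix
  \<open>det (I - zA)\<close> and \<open>det_resolvent A 0 z\<close>. The coefficients are then read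
  off one by one by alternating the limit at 0 with the recursion, which avoids power
  series.\<close>

lemma walk_count_eq:
  assumes A: "A \<in> carrier_mat n n" and B: "B \<in> carrier_mat n n"
    and cp: "char_poly A = char_poly B"
    and cpJ: "char_poly (ones_mat n - 1\<^sub>m n - A) = char_poly (ones_mat n - 1\<^sub>m n - B)"
  shows "walk_count A k = walk_count B k"
proof -
  define d where "d C z = det (1\<^sub>m n - z \<cdot>\<^sub>m C)" for C :: "complex mat" and z
  have d0: "d C 0 = 1" if C: "C \<in> carrier_mat n n" for C
  proof -
    have "1\<^sub>m n - 0 \<cdot>\<^sub>m C = 1\<^sub>m n" using C by (intro eq_matI) auto
    then show ?thesis by (simp add: d_def)
  qed
  have d_eq: "d A z = d B z" if "z \<noteq> 0" for z
    using that A B by (simp add: d_def det_one_minus_smult cp)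
  \<comment> \<open>The vector \<open>v = (z / d C z) ?x\<close> solves \<open>?M v = z e\<close>,
    so \<open>zJ\<close> is the rank-one update of \<open>?M\<close> with factors
    \<open>?M v\<close> and \<open>e\<close>.\<close>
  have res0: "z * det_resolvent C 0 z = det (1\<^sub>m n - z \<cdot>\<^sub>m C + z \<cdot>\<^sub>m ones_mat n) - d C z"
    if C: "C \<in> carrier_mat n n" and nz: "d C z \<noteq> 0" for C z
  proof -
    let ?M = "1\<^sub>m n - z \<cdot>\<^sub>m C"
    let ?x = "adj_mat ?M *\<^sub>v ones_vec n"
    have M: "?M \<in> carrier_mat n n" using C by auto
    have x: "?x \<in> carrier_vec n" using adj_mat(1)[OF M] by simp
    have "?M *\<^sub>v ?x = (?M * adj_mat ?M) *\<^sub>v ones_vec n"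
      using M adj_mat(1)[OF M] by simp
    also have "\<dots> = d C z \<cdot>\<^sub>v ones_vec n"
      by (simp add: adj_mat(2)[OF M] smult_mat_mult_vec[of _ n n] d_def)
    finally have Mv: "?M *\<^sub>v ((z / d C z) \<cdot>\<^sub>v ?x) = z \<cdot>\<^sub>v ones_vec n"
      using nz x by (simp add: mult_mat_vec[OF M x] smult_smult_assoc)
    have "z \<cdot>\<^sub>m ones_mat n = mat n n (\<lambda>(i, j). (?M *\<^sub>v ((z / d C z) \<cdot>\<^sub>v ?x)) $ i * ones_vec n $ j)"
      unfolding Mv by (intro eq_matI) (auto simp: ones_vec_def ones_mat_def)
    then have "det (?M + z \<cdot>\<^sub>m ones_mat n) = d C z * (1 + ones_vec n \<bullet> ((z / d C z) \<cdot>\<^sub>v ?x))"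
      using det_add_rank_one[OF M, of "(z / d C z) \<cdot>\<^sub>v ?x" "ones_vec n"] x by (simp add: d_def)
    also have "\<dots> = d C z + z * (ones_vec n \<bullet> ?x)"
      using nz x by (simp add: field_simps scalar_prod_smult_distrib[of _ n])
    also have "ones_vec n \<bullet> ?x = det_resolvent C 0 z"
      using C x by (simp add: det_resolvent_def)
    finally show ?thesis by simp
  qed
  have ev_nz: "\<forall>\<^sub>F z in at 0. d A z \<noteq> 0"
  proof -
    have "isCont (d A) 0"
      unfolding d_def using A by (intro continuous_det[of _ n]) (auto intro!: continuous_intros)
    then have "(d A \<longlongrightarrow> d A 0) (at 0)" by (simp add: isCont_def)
    then show ?thesis by (rule tendsto_imp_eventually_ne) (simp add: d0 A)
  qed
  \<comment> \<open>At \<open>z = 0\<close> the recursion loses its second term and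
    \<open>d C 0 = 1\<close>, so the value there is the walk count.\<close>
  have lim: "((\<lambda>z. det_resolvent C j z) \<longlongrightarrow> walk_count C j) (at 0)" if "C \<in> carrier_mat n n" for C j
    using isCont_det_resolvent[OF that, where k = j and z = 0] det_resolvent_rec[OF that, of j 0] d0[OF that]
    by (simp add: isCont_def d_def)
  \<comment> \<open>The filter \<open>at 0\<close> excludes 0 itself, so the factor \<open>z\<close>
    can be cancelled: from \<open>res0\<close> in the base case, and from the recursion in the step
    once the limit has given equality of the walk counts at \<open>j\<close>.\<close>
  have ev: "\<forall>\<^sub>F z in at 0. det_resolvent A j z = det_resolvent B j z" for j
  proof (induction j)
    case 0
    have "\<forall>\<^sub>F z in at 0. z \<noteq> (0::complex)" by (rule eventually_neq_at_within)
    with ev_nz show ?case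
    proof eventually_elim
      case (elim z)
      then have "z * det_resolvent A 0 z = z * det_resolvent B 0 z"
        using d_eq[of z] A B by (simp add: res0 det_one_minus_smult_plus_ones cpJ)
      with elim show ?case by simp
    qed
  next
    case (Suc j)
    have eq: "walk_count A j = walk_count B j"
      using tendsto_unique[OF _ lim[OF A, of j]] lim[OF B, of j] tendsto_cong[OF Suc] by simp
    have "\<forall>\<^sub>F z in at 0. z \<noteq> (0::complex)" by (rule eventually_neq_at_within)
    with Suc show ?case
    proof eventually_elim
      case (elim z)
      then show ?case
        using det_resolvent_rec[OF A, of j z] det_resolvent_rec[OF B, of j z] d_eq[of z] eq
        by (simp add: d_def)
    qed
  qed
  show ?thesis
    using tendsto_unique[OF _ lim[OF A, of k]] lim[OF B, of k] tendsto_cong[OF ev[of k]] by simp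
qed

section \<open>Gram matrices of walk matrices\<close>

lemma mat_adjoint_dim [simp]:
  "dim_row (mat_adjoint A) = dim_col A" "dim_col (mat_adjoint A) = dim_row A"
  by (auto simp: mat_adjoint_def)

lemma mat_adjoint_carrier [simp]: "A \<in> carrier_mat n m \<Longrightarrow> mat_adjoint A \<in> carrier_mat m n"
  by (auto intro!: carrier_matI)

lemma mat_adjoint_index [simp]:
  "i < dim_col A \<Longrightarrow> j < dim_row A \<Longrightarrow> mat_adjoint A $$ (i, j) = conjugate (A $$ (j, i))"
  by (simp add: mat_adjoint_def mat_of_rows_index)

lemma mat_adjoint_mult:
  fixes A B :: "complex mat"
  assumes "A \<in> carrier_mat n m" "B \<in> carrier_mat m k"
  shows "mat_adjoint (A * B) = mat_adjoint B * mat_adjoint A"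
  using assms by (intro eq_matI) (auto simp: scalar_prod_def mult.commute)

lemma mat_adjoint_one [simp]: "mat_adjoint (1\<^sub>m n) = (1\<^sub>m n :: complex mat)"
  by (intro eq_matI) auto

text \<open>The defining property of the adjoint. The product \<open>\<bullet>\<close> is bilinear,
  so the conjugation of the first argument is written out.\<close>

lemma conjugate_mult_mat_vec_scalar_prod:
  fixes A :: "complex mat"
  assumes A: "A \<in> carrier_mat n m" and v: "v \<in> carrier_vec m" and x: "x \<in> carrier_vec n"
  shows "conjugate (A *\<^sub>v v) \<bullet> x = conjugate v \<bullet> (mat_adjoint A *\<^sub>v x)"
proof -
  have "conjugate (A *\<^sub>v v) \<bullet> x = (\<Sum>i<n. \<Sum>j<m. cnj (A $$ (i, j)) * cnj (v $ j) * x $ i)"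
    using A v x by (auto simp: scalar_prod_def lessThan_atLeast0 sum_distrib_right intro!: sum.cong)
  also have "\<dots> = (\<Sum>j<m. \<Sum>i<n. cnj (A $$ (i, j)) * cnj (v $ j) * x $ i)"
    by (rule sum.swap)
  also have "\<dots> = conjugate v \<bullet> (mat_adjoint A *\<^sub>v x)"
    using A v x by (auto simp: scalar_prod_def lessThan_atLeast0 sum_distrib_left mult_ac intro!: sum.cong)
  finally show ?thesis .
qed

lemma pow_mat_add:
  fixes A :: "'a :: semiring_1 mat"
  assumes "A \<in> carrier_mat n n"
  shows "A ^\<^sub>m (k + l) = A ^\<^sub>m k * A ^\<^sub>m l"
  using assms by (induction l) (auto simp: assoc_mult_mat[of _ n n _ n _ n])

lemma conjugate_pow_mult_mat_vec_scalar_prod: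
  fixes A :: "complex mat"
  assumes A: "A \<in> carrier_mat n n" and herm: "mat_adjoint A = A"
    and v: "v \<in> carrier_vec n" and x: "x \<in> carrier_vec n"
  shows "conjugate (A ^\<^sub>m k *\<^sub>v v) \<bullet> x = conjugate v \<bullet> (A ^\<^sub>m k *\<^sub>v x)"
  using v x
proof (induction k arbitrary: v x)
  case 0
  then show ?case using A by simp
next
  case (Suc k)
  have P: "A ^\<^sub>m k \<in> carrier_mat n n" using A by simp
  have "conjugate (A ^\<^sub>m Suc k *\<^sub>v v) \<bullet> x = conjugate (A ^\<^sub>m k *\<^sub>v (A *\<^sub>v v)) \<bullet> x"
    using A P Suc.prems by (simp add: assoc_mult_mat_vec[of _ n n])
  also have "\<dots> = conjugate (A *\<^sub>v v) \<bullet> (A ^\<^sub>m k *\<^sub>v x)"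
    using A Suc.prems by (intro Suc.IH) auto
  also have "\<dots> = conjugate v \<bullet> (A *\<^sub>v (A ^\<^sub>m k *\<^sub>v x))"
    using A Suc.prems mult_mat_vec_carrier[OF P]
    by (subst conjugate_mult_mat_vec_scalar_prod[of _ n n]) (auto simp: herm)
  also have "A *\<^sub>v (A ^\<^sub>m k *\<^sub>v x) = (A * A ^\<^sub>m k) *\<^sub>v x"
    using A P Suc.prems by (simp add: assoc_mult_mat_vec[of _ n n _ n])
  \<comment> \<open>Matrix powers grow on the right by definition; additivity of exponents supplies
    the factor on the left.\<close>
  also have "A * A ^\<^sub>m k = A ^\<^sub>m Suc k"
    using pow_mat_add[OF A, of 1 k] A by simp
  finally show ?case .
qed

section \<open>Walk matrices\<close>

lemma walk_matrix_carrier [simp]: "walk_matrix n A \<in> carrier_mat n n"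
  by (auto simp: walk_matrix_def intro!: carrier_matI)

lemma col_walk_matrix [simp]:
  "A \<in> carrier_mat n n \<Longrightarrow> j < n \<Longrightarrow> col (walk_matrix n A) j = A ^\<^sub>m j *\<^sub>v ones_vec n"
  unfolding walk_matrix_def
  by (subst col_mat_of_cols) (auto intro!: mult_mat_vec_carrier[of _ n n])

lemma pow_mat_add_vec:
  fixes A :: "'a :: semiring_1 mat"
  assumes "A \<in> carrier_mat n n" "v \<in> carrier_vec n"
  shows "A ^\<^sub>m k *\<^sub>v (A ^\<^sub>m l *\<^sub>v v) = A ^\<^sub>m (k + l) *\<^sub>v v"
  using assms by (simp add: pow_mat_add[of _ n] assoc_mult_mat_vec[of _ n n _ n])

text \<open>Entry \<open>(i, j)\<close> is the Hermitian product of \<open>A^i e\<close> and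
  \<open>A^(k + j) e\<close>. Since \<open>A\<close> is Hermitian, \<open>A^i\<close> moves to the
  other side, and \<open>e\<close> is real. The cases \<open>k = 0\<close> and \<open>k = 1\<close>
  later give unitarity and the conjugation of \<open>A\<close>.\<close>

lemma walk_matrix_gram:
  assumes A: "A \<in> carrier_mat n n" and herm: "mat_adjoint A = A"
  shows "mat_adjoint (walk_matrix n A) * (A ^\<^sub>m k * walk_matrix n A) =
    mat n n (\<lambda>(i, j). walk_count A (i + (k + j)))"
proof (rule eq_matI)
  let ?W = "walk_matrix n A" and ?e = "ones_vec n"
  have W: "?W \<in> carrier_mat n n" by simp
  have P: "A ^\<^sub>m k \<in> carrier_mat n n" for k using A by simp
  fix i j assume "i < dim_row (mat n n (\<lambda>(i, j). walk_count A (i + (k + j))))"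
    "j < dim_col (mat n n (\<lambda>(i, j). walk_count A (i + (k + j))))"
  then have i: "i < n" and j: "j < n" by auto
  have "row (mat_adjoint ?W) i = conjugate (col ?W i)"
    using i carrier_matD[OF W] by (intro eq_vecI) auto
  then have row: "row (mat_adjoint ?W) i = conjugate (A ^\<^sub>m i *\<^sub>v ?e)"
    using A i by simp
  have "col (A ^\<^sub>m k * ?W) j = A ^\<^sub>m k *\<^sub>v (A ^\<^sub>m j *\<^sub>v ?e)"
    using A P[of k] W j by (subst col_mult2[of _ n n _ n]) auto
  then have col: "col (A ^\<^sub>m k * ?W) j = A ^\<^sub>m (k + j) *\<^sub>v ?e"
    using A by (simp add: pow_mat_add_vec)
  have "(mat_adjoint ?W * (A ^\<^sub>m k * ?W)) $$ (i, j) = row (mat_adjoint ?W) i \<bullet> col (A ^\<^sub>m k * ?W) j"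
    using i j W P[of k] by (subst index_mult_mat) (simp_all add: carrier_matD[OF W])
  also have "\<dots> = conjugate ?e \<bullet> (A ^\<^sub>m i *\<^sub>v (A ^\<^sub>m (k + j) *\<^sub>v ?e))"
    unfolding row col
    by (intro conjugate_pow_mult_mat_vec_scalar_prod[OF A herm] mult_mat_vec_carrier[OF P]) simp_all
  also have "conjugate ?e = ?e" by (intro eq_vecI) (auto simp: ones_vec_def)
  also have "?e \<bullet> (A ^\<^sub>m i *\<^sub>v (A ^\<^sub>m (k + j) *\<^sub>v ?e)) = walk_count A (i + (k + j))"
    using A by (simp add: pow_mat_add_vec walk_count_def)
  finally show "(mat_adjoint ?W * (A ^\<^sub>m k * ?W)) $$ (i, j) =
      mat n n (\<lambda>(i, j). walk_count A (i + (k + j))) $$ (i, j)"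
    using i j by simp
qed (use carrier_matD[OF walk_matrix_carrier[of n A]] in auto)

section \<open>Gaussian rational matrices\<close>

definition gaussian_rationals :: "complex set" where
  "gaussian_rationals = {z. Re z \<in> \<rat> \<and> Im z \<in> \<rat>}"

lemma gaussian_rational_mat_iff:
  "A \<in> carrier_mat n m \<Longrightarrow>
    gaussian_rational_mat A \<longleftrightarrow> (\<forall>i<n. \<forall>j<m. A $$ (i, j) \<in> gaussian_rationals)"
  by (auto simp: gaussian_rational_mat_def gaussian_rationals_def)

lemma gaussian_rationals_closed:
  "0 \<in> gaussian_rationals" "1 \<in> gaussian_rationals" "\<i> \<in> gaussian_rationals"
  "of_int k \<in> gaussian_rationals"
  "x \<in> gaussian_rationals \<Longrightarrow> - x \<in> gaussian_rationals"
  "x \<in> gaussian_rationals \<Longrightarrow> y \<in> gaussian_rationals \<Longrightarrow> x + y \<in> gaussian_rationals"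
  "x \<in> gaussian_rationals \<Longrightarrow> y \<in> gaussian_rationals \<Longrightarrow> x * y \<in> gaussian_rationals"
  "x \<in> gaussian_rationals \<Longrightarrow> inverse x \<in> gaussian_rationals"
  by (auto simp: gaussian_rationals_def power2_eq_square)

lemma gaussian_rationals_sum:
  "(\<And>i. i \<in> I \<Longrightarrow> f i \<in> gaussian_rationals) \<Longrightarrow> sum f I \<in> gaussian_rationals"
  by (induction I rule: infinite_finite_induct) (auto intro!: gaussian_rationals_closed)

lemma gaussian_rationals_prod:
  "(\<And>i. i \<in> I \<Longrightarrow> f i \<in> gaussian_rationals) \<Longrightarrow> prod f I \<in> gaussian_rationals"
  by (induction I rule: infinite_finite_induct) (auto intro!: gaussian_rationals_closed)

lemma gaussian_rational_mat_mult:
  assumes "A \<in> carrier_mat n m" "B \<in> carrier_mat m k"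
    "gaussian_rational_mat A" "gaussian_rational_mat B"
  shows "gaussian_rational_mat (A * B)"
  using assms
  by (auto simp: gaussian_rational_mat_iff[of "A * B" n k] gaussian_rational_mat_iff[of A n m]
      gaussian_rational_mat_iff[of B m k] scalar_prod_def
      intro!: gaussian_rationals_sum gaussian_rationals_closed)

lemma gaussian_rational_mat_pow:
  assumes A: "A \<in> carrier_mat n n" "gaussian_rational_mat A"
  shows "gaussian_rational_mat (A ^\<^sub>m k)"
proof (induction k)
  case 0
  show ?case using A by (auto simp: gaussian_rational_mat_def one_mat_def)
next
  case (Suc k)
  then show ?case using A gaussian_rational_mat_mult[of "A ^\<^sub>m k" n n A n] by simp
qed

lemma gaussian_rational_det:
  assumes "A \<in> carrier_mat n n" "gaussian_rational_mat A"
  shows "det A \<in> gaussian_rationals"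
  using assms
  by (auto simp: det_def'[of _ n] gaussian_rational_mat_iff[of _ n n] permutes_in_image
      intro!: gaussian_rationals_sum gaussian_rationals_closed gaussian_rationals_prod)

lemma gaussian_rational_adj_mat:
  assumes A: "A \<in> carrier_mat n n" "gaussian_rational_mat A"
  shows "gaussian_rational_mat (adj_mat A)"
proof -
  have "det (mat_delete A i j) \<in> gaussian_rationals" if "i < n" "j < n" for i j
  proof (rule gaussian_rational_det)
    show "mat_delete A i j \<in> carrier_mat (n - 1) (n - 1)"
      using A mat_delete_carrier by blast
    then show "gaussian_rational_mat (mat_delete A i j)"
      using A that by (auto simp: gaussian_rational_mat_def mat_delete_def)
  qed
  moreover have "(- 1) ^ k \<in> gaussian_rationals" for k
    by (induction k) (auto intro!: gaussian_rationals_closed)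
  ultimately show ?thesis
    using A adj_mat(1)[OF A(1)]
    by (auto simp: gaussian_rational_mat_iff[of _ n n] adj_mat_def cofactor_def
        intro!: gaussian_rationals_closed)
qed

lemma gaussian_rational_walk_matrix:
  assumes A: "A \<in> carrier_mat n n" "gaussian_rational_mat A"
  shows "gaussian_rational_mat (walk_matrix n A)"
proof -
  have "walk_matrix n A $$ (i, j) \<in> gaussian_rationals" if ij: "i < n" "j < n" for i j
  proof -
    have P: "A ^\<^sub>m j \<in> carrier_mat n n" using A by simp
    have "walk_matrix n A $$ (i, j) = col (walk_matrix n A) j $ i"
      using ij carrier_matD[OF walk_matrix_carrier[of n A]] by simp
    also have "\<dots> = (\<Sum>k<n. (A ^\<^sub>m j) $$ (i, k))"
      using A ij P by (auto simp: scalar_prod_def ones_vec_def lessThan_atLeast0)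
    also have "\<dots> \<in> gaussian_rationals"
      using gaussian_rational_mat_pow[OF A, of j] P ij
      by (auto simp: gaussian_rational_mat_iff[of _ n n] intro!: gaussian_rationals_sum)
    finally show ?thesis .
  qed
  then show ?thesis by (simp add: gaussian_rational_mat_iff[of _ n n])
qed

text \<open>The adjugate divided by the determinant stays inside the field of Gaussian rationals.
  Rationality is a conditional conclusion, so that the lemma also serves as a plain source of
  inverses.\<close>

lemma gaussian_rational_inverse_exists:
  fixes A :: "complex mat"
  assumes A: "A \<in> carrier_mat n n" and nz: "det A \<noteq> 0"
  obtains V where "V \<in> carrier_mat n n" "A * V = 1\<^sub>m n" "V * A = 1\<^sub>m n"
    "gaussian_rational_mat A \<Longrightarrow> gaussian_rational_mat V"
proof
  let ?V = "inverse (det A) \<cdot>\<^sub>m adj_mat A"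
  note adj = adj_mat[OF A]
  show "?V \<in> carrier_mat n n" using adj by simp
  show "A * ?V = 1\<^sub>m n"
    using A adj nz by (simp add: mult_smult_distrib[of _ n n]) (intro eq_matI; auto)
  show "?V * A = 1\<^sub>m n"
    using A adj nz by (simp add: mult_smult_assoc_mat[of _ n n]) (intro eq_matI; auto)
  show "gaussian_rational_mat ?V" if "gaussian_rational_mat A"
    using gaussian_rational_adj_mat[OF A that] gaussian_rational_det[OF A that] adj(1)
    by (auto simp: gaussian_rational_mat_iff[of _ n n] intro!: gaussian_rationals_closed)
qed

section \<open>Unitary matrices fixing the all-one vector\<close>

text \<open>Column 0 is \<open>A^0 e = e\<close>. Two walk matrices thus agree on
  \<open>unit_vec n 0\<close>, which is why their quotient fixes \<open>e\<close>.\<close>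

lemma walk_matrix_mult_unit_vec:
  assumes "A \<in> carrier_mat n n" "0 < n"
  shows "walk_matrix n A *\<^sub>v unit_vec n 0 = ones_vec n"
proof -
  have "walk_matrix n A *\<^sub>v unit_vec n 0 = col (walk_matrix n A) 0"
    using assms carrier_matD[OF walk_matrix_carrier[of n A]]
    by (intro eq_vecI) (auto simp del: col_walk_matrix)
  then show ?thesis using assms by simp
qed

text \<open>Let \<open>X\<close> and \<open>Y\<close> be the walk matrices of \<open>A\<close> and
  \<open>B\<close>, and \<open>U = X V\<close> with \<open>V\<close> the inverse of
  \<open>Y\<close>. Equal walk counts make the Gram matrices of \<open>X\<close> and
  \<open>Y\<close> agree, both plain and weighted by \<open>A\<close> and \<open>B\<close>;
  multiplying by \<open>V\<close> and its adjoint turns this into unitarity and the conjugation of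
  \<open>A\<close> to \<open>B\<close>.\<close>

lemma unitary_of_walk_count_eq:
  assumes A: "A \<in> carrier_mat n n" "mat_adjoint A = A" "gaussian_rational_mat A"
    and B: "B \<in> carrier_mat n n" "mat_adjoint B = B" "gaussian_rational_mat B"
    and nz: "det (walk_matrix n A) \<noteq> 0"
    and eq: "\<And>k. walk_count A k = walk_count B k"
  obtains U where "U \<in> carrier_mat n n" "gaussian_rational_mat U" "mat_adjoint U * U = 1\<^sub>m n"
    "U *\<^sub>v ones_vec n = ones_vec n" "mat_adjoint U * A * U = B"
proof -
  define X where "X = walk_matrix n A"
  define Y where "Y = walk_matrix n B"
  have X: "X \<in> carrier_mat n n" and Y: "Y \<in> carrier_mat n n"
    by (simp_all add: X_def Y_def)
  have gram: "mat_adjoint X * X = mat_adjoint Y * Y"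
    using walk_matrix_gram[OF A(1,2), of 0] walk_matrix_gram[OF B(1,2), of 0] A(1) B(1) eq
    by (simp add: X_def Y_def left_mult_one_mat[of _ n n])
  have gram1: "mat_adjoint X * (A * X) = mat_adjoint Y * (B * Y)"
    using walk_matrix_gram[OF A(1,2), of 1] walk_matrix_gram[OF B(1,2), of 1] A(1) B(1) eq
    by (simp add: X_def Y_def)
  \<comment> \<open>Only \<open>X\<close> is assumed invertible. Taking determinants in
    \<open>gram\<close> carries this over to \<open>Y\<close>, once the adjoint of \<open>X\<close>
    is known to be invertible.\<close>
  have "det (mat_adjoint X) \<noteq> 0"
  proof -
    obtain V where V: "V \<in> carrier_mat n n" "X * V = 1\<^sub>m n"
      using gaussian_rational_inverse_exists[OF X] nz by (metis X_def)
    then have "mat_adjoint V * mat_adjoint X = 1\<^sub>m n"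
      using mat_adjoint_mult[OF X V(1)] by simp
    then have "det (mat_adjoint V) * det (mat_adjoint X) = 1"
      using V(1) X by (metis det_mult det_one mat_adjoint_carrier)
    then show ?thesis by auto
  qed
  moreover have "det (mat_adjoint X) * det X = det (mat_adjoint Y) * det Y"
    using gram X Y by (metis det_mult mat_adjoint_carrier)
  ultimately have "det Y \<noteq> 0"
    using nz by (auto simp: X_def)
  then obtain V where V: "V \<in> carrier_mat n n" "Y * V = 1\<^sub>m n" "V * Y = 1\<^sub>m n" "gaussian_rational_mat V"
    using gaussian_rational_inverse_exists[OF Y] gaussian_rational_walk_matrix[OF B(1,3)]
    by (metis Y_def)
  define U where "U = X * V"
  have U: "U \<in> carrier_mat n n" using X V by (simp add: U_def)
  have adjU: "mat_adjoint U = mat_adjoint V * mat_adjoint X"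
    unfolding U_def using X V(1) by (rule mat_adjoint_mult)
  note carr = A(1) B(1) X Y V(1) mat_adjoint_carrier[OF V(1)] mat_adjoint_carrier[OF X] mat_adjoint_carrier[OF Y]
  note assoc = assoc_mult_mat[of _ n n _ n _ n] mult_carrier_mat[of _ n n _ n]
  have adjYV: "mat_adjoint V * mat_adjoint Y = 1\<^sub>m n"
    using mat_adjoint_mult[OF Y V(1)] V(2) by simp
  have "mat_adjoint U * U = mat_adjoint V * (mat_adjoint X * X) * V"
    unfolding adjU unfolding U_def using carr by (simp add: assoc)
  also have "\<dots> = (mat_adjoint V * mat_adjoint Y) * (Y * V)"
    unfolding gram using carr by (simp add: assoc)
  finally have unitary: "mat_adjoint U * U = 1\<^sub>m n" by (simp add: adjYV V(2))
  have "mat_adjoint U * A * U = mat_adjoint V * (mat_adjoint X * (A * X)) * V"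
    unfolding adjU unfolding U_def using carr by (simp add: assoc)
  also have "\<dots> = (mat_adjoint V * mat_adjoint Y) * B * (Y * V)"
    unfolding gram1 using carr by (simp add: assoc)
  finally have conj: "mat_adjoint U * A * U = B" using carr by (simp add: adjYV V(2))
  have "U *\<^sub>v ones_vec n = ones_vec n"
  proof (cases "n = 0")
    case False
    then have "V *\<^sub>v ones_vec n = V *\<^sub>v (Y *\<^sub>v unit_vec n 0)"
      using B(1) by (simp add: Y_def walk_matrix_mult_unit_vec)
    also have "\<dots> = (V * Y) *\<^sub>v unit_vec n 0"
      using carr by (simp add: assoc_mult_mat_vec[of _ n n _ n])
    finally have "V *\<^sub>v ones_vec n = unit_vec n 0" by (simp add: V(3))
    moreover have "U *\<^sub>v ones_vec n = X *\<^sub>v (V *\<^sub>v ones_vec n)"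
      using carr by (simp add: U_def assoc_mult_mat_vec[of _ n n _ n])
    ultimately show ?thesis
      using False A(1) by (simp add: X_def walk_matrix_mult_unit_vec)
  qed (use U in \<open>auto simp: ones_vec_def intro!: eq_vecI\<close>)
  moreover have "gaussian_rational_mat U"
    unfolding U_def using X V gaussian_rational_walk_matrix[OF A(1,3)]
    by (intro gaussian_rational_mat_mult[of _ n n _ n]) (auto simp: X_def)
  ultimately show thesis
    using that U unitary conj by blast
qed

text \<open>Invertibility of \<open>W\<close> says that \<open>e\<close> is a cyclic vector of
  \<open>A\<close>, and a matrix commuting with \<open>A\<close> is determined by its value on a
  cyclic vector.\<close>

lemma commuting_mat_fixing_ones_eq_one:
  assumes A: "A \<in> carrier_mat n n" and nz: "det (walk_matrix n A) \<noteq> 0"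
    and Q: "Q \<in> carrier_mat n n" "Q * A = A * Q" "Q *\<^sub>v ones_vec n = ones_vec n"
  shows "Q = 1\<^sub>m n"
proof -
  let ?W = "walk_matrix n A"
  have W: "?W \<in> carrier_mat n n" by simp
  have P: "A ^\<^sub>m k \<in> carrier_mat n n" for k using A by simp
  have comm: "Q * A ^\<^sub>m k = A ^\<^sub>m k * Q" for k
  proof (induction k)
    case (Suc k)
    have "Q * A ^\<^sub>m Suc k = (Q * A ^\<^sub>m k) * A"
      using A Q(1) P[of k] by (simp add: assoc_mult_mat[of _ n n _ n _ n])
    also have "\<dots> = A ^\<^sub>m k * (Q * A)"
      using A Q(1) P[of k] by (simp add: Suc assoc_mult_mat[of _ n n _ n _ n])
    also have "\<dots> = A ^\<^sub>m Suc k * Q"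
      using A Q(1) P[of k] by (simp add: Q(2) assoc_mult_mat[of _ n n _ n _ n])
    finally show ?case .
  qed (use A Q(1) in simp)
  have "col (Q * ?W) j = col ?W j" if "j < n" for j
  proof -
    have "col (Q * ?W) j = Q *\<^sub>v (A ^\<^sub>m j *\<^sub>v ones_vec n)"
      using that A by (simp add: col_mult2[OF Q(1) W])
    also have "\<dots> = (A ^\<^sub>m j * Q) *\<^sub>v ones_vec n"
      using Q(1) P[of j] by (simp add: comm[symmetric] assoc_mult_mat_vec[of _ n n _ n])
    also have "\<dots> = col ?W j"
      using Q(1,3) P[of j] A that by (simp add: assoc_mult_mat_vec[of _ n n _ n])
    finally show ?thesis .
  qed
  then have QW: "Q * ?W = ?W"
    using Q(1) carrier_matD[OF W] by (intro mat_col_eqI) auto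
  obtain V where V: "V \<in> carrier_mat n n" "?W * V = 1\<^sub>m n"
    using gaussian_rational_inverse_exists[OF W nz] by metis
  have "Q = Q * (?W * V)" using Q(1) V(2) by simp
  also have "\<dots> = (Q * ?W) * V" using Q(1) V(1) W by (simp add: assoc_mult_mat[of _ n n _ n _ n])
  finally show ?thesis by (simp add: QW V(2))
qed

lemma mult_ones_mat:
  assumes "M \<in> carrier_mat n n" "M *\<^sub>v ones_vec n = ones_vec n"
  shows "M * ones_mat n = ones_mat n"
proof (rule eq_matI)
  fix i j assume "i < dim_row (ones_mat n)" "j < dim_col (ones_mat n)"
  then have ij: "i < n" "j < n" by (auto simp: ones_mat_def)
  have "col (ones_mat n) j = ones_vec n"
    using ij by (auto simp: ones_mat_def ones_vec_def)
  then have "(M * ones_mat n) $$ (i, j) = (M *\<^sub>v ones_vec n) $ i"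
    using ij assms(1) by (simp add: ones_mat_def)
  also have "\<dots> = ones_mat n $$ (i, j)"
    unfolding assms(2) using ij by (simp add: ones_mat_def ones_vec_def)
  finally show "(M * ones_mat n) $$ (i, j) = ones_mat n $$ (i, j)" .
qed (use assms in \<open>auto simp: ones_mat_def\<close>)

lemma unitary_mult_adjoint:
  assumes "U \<in> carrier_mat n n" "mat_adjoint U * U = 1\<^sub>m n"
  shows "U * mat_adjoint U = (1\<^sub>m n :: complex mat)"
  using mat_adjoint_carrier[OF assms(1)] assms by (rule mat_mult_left_right_inverse)

lemma adjoint_mult_ones_vec:
  assumes "U \<in> carrier_mat n n" "mat_adjoint U * U = 1\<^sub>m n" "U *\<^sub>v ones_vec n = ones_vec n"
  shows "mat_adjoint U *\<^sub>v ones_vec n = ones_vec n"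
proof -
  have "mat_adjoint U *\<^sub>v ones_vec n = mat_adjoint U *\<^sub>v (U *\<^sub>v ones_vec n)"
    by (simp add: assms(3))
  also have "\<dots> = (mat_adjoint U * U) *\<^sub>v ones_vec n"
    using assms(1) by (simp add: assoc_mult_mat_vec[of _ n n _ n])
  finally show ?thesis by (simp add: assms(2))
qed

text \<open>Conjugation by \<open>U\<close> is a similarity, and it fixes \<open>J\<close> as well
  as \<open>I\<close> because \<open>U\<close> and its adjoint both fix \<open>e\<close>. It
  therefore takes the complement of \<open>A\<close> to the complement of the conjugate.\<close>

lemma gen_spectrum_unitary_invariant:
  assumes A: "A \<in> carrier_mat n n"
    and U: "U \<in> carrier_mat n n" "mat_adjoint U * U = 1\<^sub>m n" "U *\<^sub>v ones_vec n = ones_vec n"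
  shows "Spec (mat_adjoint U * A * U) = Spec A"
    and "Spec (ones_mat n - 1\<^sub>m n - mat_adjoint U * A * U) = Spec (ones_mat n - 1\<^sub>m n - A)"
proof -
  let ?J = "ones_mat n" and ?U = "mat_adjoint U"
  have U': "?U \<in> carrier_mat n n" using U(1) by simp
  have Spec_conj: "Spec (?U * M * U) = Spec M" if M: "M \<in> carrier_mat n n" for M
  proof -
    have "similar_mat (?U * M * U) M"
      using U U' M unitary_mult_adjoint[OF U(1,2)]
      by (intro similar_matI[of _ _ ?U U n]) auto
    then show ?thesis by (simp add: Spec_def char_poly_similar)
  qed
  then show "Spec (?U * A * U) = Spec A" using A .
  \<comment> \<open>Fixing \<open>e\<close> gives \<open>U J = J\<close>. Its adjoint is
    \<open>J ?U = J\<close>, and multiplying by \<open>U\<close> on the right gives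
    \<open>J U = J\<close>.\<close>
  have "mat_adjoint ?J = ?J" by (intro eq_matI) (auto simp: ones_mat_def)
  then have "?J * ?U = ?J"
    using mat_adjoint_mult[OF U(1) ones_carrier(2)] mult_ones_mat[OF U(1,3)] by simp
  then have "?J * U = ?J * ?U * U" by simp
  also have "\<dots> = ?J"
    using U U' by (simp add: assoc_mult_mat[of _ n n _ n _ n] right_mult_one_mat[of _ n n])
  finally have JU: "?J * U = ?J" .
  have UJ: "?U * ?J = ?J"
    using U' adjoint_mult_ones_vec[OF U] by (rule mult_ones_mat)
  have "?U * (?J - 1\<^sub>m n - A) * U = ?U * ?J * U - ?U * 1\<^sub>m n * U - ?U * A * U"
  proof -
    have J1: "?J - 1\<^sub>m n \<in> carrier_mat n n" by (simp add: minus_carrier_mat)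
    have UM: "?U * M \<in> carrier_mat n n" if "M \<in> carrier_mat n n" for M
      using U' that by (rule mult_carrier_mat)
    show ?thesis
      unfolding mult_minus_distrib_mat[OF U' J1 A]
        mult_minus_distrib_mat[OF U' ones_carrier(2) one_carrier_mat]
        minus_mult_distrib_mat[OF minus_carrier_mat[OF UM[OF one_carrier_mat]] UM[OF A] U(1)]
        minus_mult_distrib_mat[OF UM[OF ones_carrier(2)] UM[OF one_carrier_mat] U(1)]
      by (rule refl)
  qed
  also have "\<dots> = ?J - 1\<^sub>m n - ?U * A * U"
    using U U' by (simp add: UJ JU)
  finally show "Spec (?J - 1\<^sub>m n - ?U * A * U) = Spec (?J - 1\<^sub>m n - A)"
    using Spec_conj[of "?J - 1\<^sub>m n - A"] A by (simp add: minus_carrier_mat)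
qed

section \<open>Permutation matrices and isomorphisms\<close>

definition perm_mat :: "nat \<Rightarrow> (nat \<Rightarrow> nat) \<Rightarrow> complex mat" where
  "perm_mat n p = mat n n (\<lambda>(i, j). if i = p j then 1 else 0)"

lemma perm_mat_carrier [simp]: "perm_mat n p \<in> carrier_mat n n"
  by (simp add: perm_mat_def)

text \<open>Column \<open>j\<close> of \<open>perm_mat n p\<close> is the unit vector at
  \<open>p j\<close>, so each of the two products has a single surviving summand per entry.\<close>

lemma perm_mat_conj_index:
  assumes p: "p permutes {..<n}" and A: "A \<in> carrier_mat n n" and ij: "i < n" "j < n"
  shows "(mat_adjoint (perm_mat n p) * A * perm_mat n p) $$ (i, j) = A $$ (p i, p j)"
proof -
  have pn: "p k < n" if "k < n" for k using permutes_in_image[OF p, of k] that by auto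
  define M where "M = mat_adjoint (perm_mat n p) * A"
  have M: "M \<in> carrier_mat n n"
    unfolding M_def using A by (intro mult_carrier_mat[of _ n n]) auto
  have "M $$ (i, p j) = A $$ (p i, p j)"
    unfolding M_def using ij A pn
    by (auto simp: scalar_prod_def perm_mat_def if_distrib[of cnj] if_distrib[of "\<lambda>x. x * _"] cong: if_cong)
  moreover have "(M * perm_mat n p) $$ (i, j) = M $$ (i, p j)"
    using ij M pn
    by (auto simp: scalar_prod_def perm_mat_def if_distrib[of "\<lambda>x. _ * x"] cong: if_cong)
  ultimately show ?thesis by (simp add: M_def)
qed

lemma perm_mat_unitary:
  assumes p: "p permutes {..<n}"
  shows "mat_adjoint (perm_mat n p) * perm_mat n p = 1\<^sub>m n"
proof -
  \<comment> \<open>The inserted identity makes this a conjugation with known entries; injectivity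
    of \<open>p\<close> does the rest.\<close>
  have "mat_adjoint (perm_mat n p) * 1\<^sub>m n * perm_mat n p = 1\<^sub>m n" (is "?L = _")
  proof (rule eq_matI)
    fix i j assume "i < dim_row (1\<^sub>m n)" "j < dim_col (1\<^sub>m n)"
    then have ij: "i < n" "j < n" by auto
    then show "?L $$ (i, j) = 1\<^sub>m n $$ (i, j)"
      using permutes_in_image[OF p] permutes_inj[OF p]
      by (subst perm_mat_conj_index[OF p]) (auto simp: inj_eq)
  qed (auto simp: perm_mat_def)
  then show ?thesis by (simp add: right_mult_one_mat[of _ n n])
qed

lemma perm_mat_mult_ones_vec:
  assumes p: "p permutes {..<n}"
  shows "perm_mat n p *\<^sub>v ones_vec n = ones_vec n"
proof (rule eq_vecI)
  fix i assume "i < dim_vec (ones_vec n)"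
  then have i: "i < n" by (simp add: ones_vec_def)
  have "(perm_mat n p *\<^sub>v ones_vec n) $ i = (\<Sum>j<n. if i = p j then 1 else 0 :: complex)"
    using i by (simp add: perm_mat_def ones_vec_def scalar_prod_def lessThan_atLeast0)
  also have "\<dots> = (\<Sum>j<n. if i = j then 1 else 0 :: complex)"
    using sum.permute[OF p, of "\<lambda>j. if i = j then 1 else 0 :: complex"] by (simp add: o_def)
  also have "\<dots> = ones_vec n $ i"
    using i by (simp add: ones_vec_def)
  finally show "(perm_mat n p *\<^sub>v ones_vec n) $ i = ones_vec n $ i" .
qed (simp add: perm_mat_def ones_vec_def)

section \<open>Hermitian adjacency matrices of mixed graphs\<close>

lemma herm_adj_carrier [simp]: "herm_adj n G \<in> carrier_mat n n"
  by (simp add: herm_adj_def)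

lemma gaussian_rational_herm_adj: "gaussian_rational_mat (herm_adj n G)"
  by (auto simp: gaussian_rational_mat_def herm_adj_def)

lemma mixed_graphs_arcD:
  "G \<in> mixed_graphs n \<Longrightarrow> (u, v) \<in> arcs G \<Longrightarrow> (v, u) \<notin> arcs G \<and> {u, v} \<notin> uedges G"
  unfolding mixed_graphs_def by blast

text \<open>No edge is oriented both ways, so the values \<open>\<i>\<close> and
  \<open>- \<i>\<close> occur in transposed positions.\<close>

lemma mat_adjoint_herm_adj:
  assumes G: "G \<in> mixed_graphs n"
  shows "mat_adjoint (herm_adj n G) = herm_adj n G"
proof (rule eq_matI)
  fix u v assume "u < dim_row (herm_adj n G)" "v < dim_col (herm_adj n G)"
  then show "mat_adjoint (herm_adj n G) $$ (u, v) = herm_adj n G $$ (u, v)"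
    using mixed_graphs_arcD[OF G, of u v] by (simp add: herm_adj_def insert_commute[of v u])
qed (simp_all add: herm_adj_def)

lemma herm_adj_eq_1_iff:
  "u < n \<Longrightarrow> v < n \<Longrightarrow> herm_adj n G $$ (u, v) = 1 \<longleftrightarrow> {u, v} \<in> uedges G"
  by (auto simp: herm_adj_def complex_eq_iff)

text \<open>Undirected edges take precedence in \<open>herm_adj\<close>; arcs can be read off
  because a pair carrying an arc is not also an undirected edge.\<close>

lemma herm_adj_eq_i_iff:
  "G \<in> mixed_graphs n \<Longrightarrow> u < n \<Longrightarrow> v < n \<Longrightarrow> herm_adj n G $$ (u, v) = \<i> \<longleftrightarrow> (u, v) \<in> arcs G"
  using mixed_graphs_arcD[of G n u v] by (simp add: herm_adj_def complex_eq_iff)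

text \<open>Conjugation by \<open>perm_mat n p\<close> relabels the vertices, and the entries
  \<open>1\<close> and \<open>\<i>\<close> of the adjacency matrix recover the undirected edges and
  the arcs.\<close>

lemma mg_isomorphic_iff_perm_mat:
  assumes H: "H \<in> mixed_graphs n" and G: "G \<in> mixed_graphs n"
  shows "mg_isomorphic n H G \<longleftrightarrow> (\<exists>p. p permutes {..<n} \<and>
    mat_adjoint (perm_mat n p) * herm_adj n G * perm_mat n p = herm_adj n H)"
proof
  assume "mg_isomorphic n H G"
  then obtain f where f: "bij_betw f {..<n} {..<n}"
    and iso: "\<And>u v. u < n \<Longrightarrow> v < n \<Longrightarrow> {u, v} \<in> uedges H \<longleftrightarrow> {f u, f v} \<in> uedges G"
      "\<And>u v. u < n \<Longrightarrow> v < n \<Longrightarrow> (u, v) \<in> arcs H \<longleftrightarrow> (f u, f v) \<in> arcs G"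
    unfolding mg_isomorphic_def by blast
  \<comment> \<open>An isomorphism is constrained on the vertices only; extending it by the identity
    yields a permutation in the sense of \<open>permutes\<close>.\<close>
  define p where "p u = (if u < n then f u else u)" for u
  have "bij_betw p {..<n} {..<n}"
    using f by (subst bij_betw_cong[of _ _ f]) (auto simp: p_def)
  then have p: "p permutes {..<n}"
    by (rule bij_imp_permutes) (simp add: p_def)
  have "mat_adjoint (perm_mat n p) * herm_adj n G * perm_mat n p = herm_adj n H"
  proof (rule eq_matI)
    fix u v assume "u < dim_row (herm_adj n H)" "v < dim_col (herm_adj n H)"
    then have uv: "u < n" "v < n" by (auto simp: herm_adj_def)
    then have "f u < n" "f v < n" using f by (auto simp: bij_betw_def)
    then show "(mat_adjoint (perm_mat n p) * herm_adj n G * perm_mat n p) $$ (u, v) = herm_adj n H $$ (u, v)"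
      unfolding perm_mat_conj_index[OF p herm_adj_carrier uv]
      using uv by (simp add: p_def herm_adj_def iso)
  qed (auto simp: perm_mat_def herm_adj_def)
  with p show "\<exists>p. p permutes {..<n} \<and>
    mat_adjoint (perm_mat n p) * herm_adj n G * perm_mat n p = herm_adj n H" by blast
next
  assume "\<exists>p. p permutes {..<n} \<and>
    mat_adjoint (perm_mat n p) * herm_adj n G * perm_mat n p = herm_adj n H"
  then obtain p where p: "p permutes {..<n}"
    and eq: "mat_adjoint (perm_mat n p) * herm_adj n G * perm_mat n p = herm_adj n H" by blast
  have "herm_adj n H $$ (u, v) = herm_adj n G $$ (p u, p v)" if "u < n" "v < n" for u v
    unfolding eq[symmetric] using perm_mat_conj_index[OF p herm_adj_carrier that] .
  moreover have "p u < n" if "u < n" for u using permutes_in_image[OF p, of u] that by auto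
  ultimately have "({u, v} \<in> uedges H \<longleftrightarrow> {p u, p v} \<in> uedges G) \<and>
      ((u, v) \<in> arcs H \<longleftrightarrow> (p u, p v) \<in> arcs G)" if "u < n" "v < n" for u v
    using that herm_adj_eq_1_iff herm_adj_eq_i_iff[OF G] herm_adj_eq_i_iff[OF H] by metis
  then show "mg_isomorphic n H G"
    unfolding mg_isomorphic_def using permutes_imp_bij[OF p] by blast
qed

section \<open>Equivalence of spectral determination and triviality of the unitary set\<close>

theorem theorem10:
  fixes n :: nat and G :: mixed_graph
  assumes "G \<in> sc_mixed_graphs n"
    and "det (walk_matrix n (herm_adj n G)) \<noteq> 0"
  shows "determined_by_gen_spectrum n G \<longleftrightarrow> unitary_set n G \<subseteq> permutation_matrices n"
proof
  let ?A = "herm_adj n G"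
  have G: "G \<in> mixed_graphs n" using assms(1) by (simp add: sc_mixed_graphs_def)
  show "unitary_set n G \<subseteq> permutation_matrices n" if det: "determined_by_gen_spectrum n G"
  proof
    fix U assume "U \<in> unitary_set n G"
    then obtain H where U: "U \<in> carrier_mat n n" "mat_adjoint U * U = 1\<^sub>m n"
        "U *\<^sub>v ones_vec n = ones_vec n"
      and H: "H \<in> sc_mixed_graphs n" and UH: "mat_adjoint U * ?A * U = herm_adj n H"
      by (auto simp: unitary_set_def)
    have "mg_isomorphic n H G"
      using det H gen_spectrum_unitary_invariant[OF herm_adj_carrier U, of G]
      unfolding determined_by_gen_spectrum_def UH by blast
    then obtain p where p: "p permutes {..<n}"
      and pH: "mat_adjoint (perm_mat n p) * ?A * perm_mat n p = herm_adj n H"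
      using mg_isomorphic_iff_perm_mat[OF _ G] H by (auto simp: sc_mixed_graphs_def)
    define P where "P = perm_mat n p"
    have P: "P \<in> carrier_mat n n" "mat_adjoint P * P = 1\<^sub>m n" "P *\<^sub>v ones_vec n = ones_vec n"
      using perm_mat_unitary[OF p] perm_mat_mult_ones_vec[OF p] by (auto simp: P_def)
    note carr = U(1) P(1) mat_adjoint_carrier[OF U(1)] mat_adjoint_carrier[OF P(1)]
    note assoc = assoc_mult_mat[of _ n n _ n _ n] mult_carrier_mat[of _ n n _ n]
    \<comment> \<open>Both conjugations are rewritten as intertwining relations,
      \<open>U A(H) = A U\<close> and \<open>A(H) Q = Q A\<close> with \<open>Q\<close> the adjoint
      of \<open>P\<close>. Chained through \<open>A(H)\<close>, they show that \<open>U Q\<close>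
      commutes with \<open>A\<close>.\<close>
    have "U * herm_adj n H = (U * mat_adjoint U) * (?A * U)"
      unfolding UH[symmetric] using carr by (simp add: assoc)
    then have UA: "U * herm_adj n H = ?A * U"
      using carr unitary_mult_adjoint[OF U(1,2)] by (simp add: assoc left_mult_one_mat[of _ n n])
    have "herm_adj n H * mat_adjoint P = mat_adjoint P * ?A * (P * mat_adjoint P)"
      unfolding pH[symmetric] P_def[symmetric] using carr by (simp add: assoc)
    then have PA: "herm_adj n H * mat_adjoint P = mat_adjoint P * ?A"
      using carr unitary_mult_adjoint[OF P(1,2)] by (simp add: assoc right_mult_one_mat[of _ n n])
    have "U * mat_adjoint P = 1\<^sub>m n"
    proof (rule commuting_mat_fixing_ones_eq_one[OF herm_adj_carrier assms(2)])
      show "U * mat_adjoint P \<in> carrier_mat n n" using carr by simp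
      have "U * mat_adjoint P * ?A = U * herm_adj n H * mat_adjoint P"
        using carr by (simp add: assoc PA)
      then show "U * mat_adjoint P * ?A = ?A * (U * mat_adjoint P)"
        using carr by (simp add: UA assoc)
      show "U * mat_adjoint P *\<^sub>v ones_vec n = ones_vec n"
        using carr U(3) adjoint_mult_ones_vec[OF P] by (simp add: assoc_mult_mat_vec[of _ n n _ n])
    qed
    then have "P = U * mat_adjoint P * P" using P(1) by simp
    also have "\<dots> = U" using carr P(2) by (simp add: assoc)
    finally show "U \<in> permutation_matrices n"
      using p by (auto simp: permutation_matrices_def P_def perm_mat_def)
  qed
  show "determined_by_gen_spectrum n G" if sub: "unitary_set n G \<subseteq> permutation_matrices n"
    unfolding determined_by_gen_spectrum_def
  proof (intro ballI impI)
    fix H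
    assume sc: "H \<in> sc_mixed_graphs n"
      and spec: "(Spec (herm_adj n H), Spec (ones_mat n - 1\<^sub>m n - herm_adj n H)) =
        (Spec ?A, Spec (ones_mat n - 1\<^sub>m n - ?A))"
    have H: "H \<in> mixed_graphs n" using sc by (simp add: sc_mixed_graphs_def)
    have "char_poly ?A = char_poly (herm_adj n H)"
      "char_poly (ones_mat n - 1\<^sub>m n - ?A) = char_poly (ones_mat n - 1\<^sub>m n - herm_adj n H)"
      using spec by (auto intro!: char_poly_eq_if_Spec_eq[of _ n] simp: minus_carrier_mat)
    then have "walk_count ?A k = walk_count (herm_adj n H) k" for k
      by (intro walk_count_eq[of _ n]) simp_all
    then obtain U where U: "U \<in> carrier_mat n n" "gaussian_rational_mat U"
      "mat_adjoint U * U = 1\<^sub>m n" "U *\<^sub>v ones_vec n = ones_vec n"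
      "mat_adjoint U * ?A * U = herm_adj n H"
      using unitary_of_walk_count_eq[OF herm_adj_carrier mat_adjoint_herm_adj[OF G]
          gaussian_rational_herm_adj herm_adj_carrier mat_adjoint_herm_adj[OF H]
          gaussian_rational_herm_adj assms(2)] by metis
    then have "U \<in> permutation_matrices n"
      using sub sc by (auto simp: unitary_set_def)
    then obtain p where "p permutes {..<n}" "U = perm_mat n p"
      by (auto simp: permutation_matrices_def perm_mat_def)
    with U(5) show "mg_isomorphic n H G"
      using mg_isomorphic_iff_perm_mat[OF H G] by blast
  qed
qed

end
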